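(* Let $A$ be an $n\times n$ Hamiltonian matrix with spectrum $\Lambda=\{\lambda_1,\lambda_2,\ldots,\lambda_n\}$, and for some $r<n$, let $\{x_1,x_2,\ldots,x_r\}$ be a set of eigenvectors of $A$ corresponding to $\lambda_1,\ldots,\lambda_r$, respectively. Let $X$ be the $n\times r$ matrix with $i$-th column $x_i$ and $\operatorname{rank}(X)=r$. Let $\Omega=\operatorname{diag}\{\lambda_1,\ldots,\lambda_r\}$, and let $C$ be an $r\times r$ Hamiltonian matrix. Then the matrix $A+XCX^{\mathcal H}$ is Hamiltonian with eigenvalues $\{\mu_1,\mu_2,\ldots,\mu_r,\lambda_{r+1},\ldots,\lambda_n\}$, where $\mu_1,\mu_2,\ldots,\mu_r$ are eigenvalues of $B=\Omega+CX^{\mathcal H}X$.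
   Context: For an even positive integer $k$, let $J_k=\begin{pmatrix}0&I_{k/2}\\-I_{k/2}&0\end{pmatrix}$, a $k\times k$ matrix, where $I_{k/2}$ is the identity matrix of order $k/2$. A real $k\times k$ matrix $M$ ($k$ even) is called Hamiltonian if $M^TJ_k+J_kM=0$; thus the order of a Hamiltonian matrix is even, and in particular $n$ and $r$ are even here. For an $n\times r$ matrix $X$ with $n,r$ even, its Hamiltonian transpose is the $r\times n$ matrix $X^{\mathcal H}=J_rX^TJ_n$, where $X^T$ is the transpose of $X$. The spectrum of an $n\times n$ matrix is written as the list of its $n$ eigenvalues. *)

theory Defs
  imports "Jordan_Normal_Form.Char_Poly" "Jordan_Normal_Form.DL_Rank"
begin

definition J_mat :: "nat \<Rightarrow> 'a :: comm_ring_1 mat" where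
  "J_mat k = (let h = k div 2 in
     four_block_mat (0\<^sub>m h h) (1\<^sub>m h) (- 1\<^sub>m h) (0\<^sub>m h h))"

(* At type real mat this is the usual notion of a (real) Hamiltonian matrix. At type complex mat
   it is the same identity, with the plain transpose and no conjugation; a real matrix satisfies
   it over the reals iff its complex embedding satisfies it over the complex numbers. *)
definition hamiltonian :: "'a :: comm_ring_1 mat \<Rightarrow> bool" where
  "hamiltonian M \<longleftrightarrow> (let k = dim_row M in
     M \<in> carrier_mat k k \<and> 0 < k \<and> even k \<and>
     transpose_mat M * J_mat k + J_mat k * M = 0\<^sub>m k k)"

definition ham_transpose :: "'a :: comm_ring_1 mat \<Rightarrow> 'a mat" where
  "ham_transpose X = J_mat (dim_col X) * transpose_mat X * J_mat (dim_row X)"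

(* The list enumerates the eigenvalues with algebraic multiplicity, in any order. *)
definition has_spectrum :: "complex mat \<Rightarrow> complex list \<Rightarrow> bool" where
  "has_spectrum M es \<longleftrightarrow>
     M \<in> carrier_mat (length es) (length es) \<and> char_poly M = (\<Prod>e\<leftarrow>es. [:- e, 1:])"

abbreviation cmat :: "real mat \<Rightarrow> complex mat" where
  "cmat \<equiv> map_mat complex_of_real"

end

theory Submission
  imports Defs
begin

(* Write Omega for the diagonal matrix of the first r eigenvalues, K = C X^H and M = A + X K.
   The columns of X are eigenvectors, so A X = X Omega, and conjugation by the
   block matrix (I, X; 0, I) carries (A, 0; K, Omega + K X) to (M, 0; K, Omega). Hence
   char_poly M * char_poly Omega = char_poly A * char_poly B, and the factor char_poly Omega
   cancels. That M is Hamiltonian is a calculation with J: the perturbation is S J for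
   the symmetric matrix S = X (C J) X^T. *)

section \<open>Characteristic polynomial of an update along an invariant subspace\<close>

lemma char_poly_four_block_upper_right_zero:
  fixes A :: "'a :: idom mat"
  assumes A: "A \<in> carrier_mat n n" and C: "C \<in> carrier_mat m n" and D: "D \<in> carrier_mat m m"
  shows "char_poly (four_block_mat A (0\<^sub>m n m) C D) = char_poly A * char_poly D"
proof -
  \<comment> \<open>The indeterminate occurs only on the main diagonal, so the block
    \<open>C\<close> contributes constant polynomials and the zero block stays zero.\<close>
  let ?p = "map_mat (\<lambda>a. [:- a:])"
  have "char_poly_matrix (four_block_mat A (0\<^sub>m n m) C D) =
      four_block_mat (char_poly_matrix A) (0\<^sub>m n m) (?p C) (char_poly_matrix D)"
    using A C D by (intro eq_matI) (auto simp: char_poly_matrix_def)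
  also have "det \<dots> = det (char_poly_matrix A) * det (char_poly_matrix D)"
    using A C D by (intro det_four_block_mat_upper_right_zero) auto
  finally show ?thesis by (simp add: char_poly_def)
qed

text \<open>The hypothesis on \<open>A * X\<close> makes the column space of \<open>X\<close>
  invariant under \<open>A\<close>. Bordering to order n + r avoids choosing a complement of that
  space: \<open>?S\<close> and \<open>?T\<close> are block triangular and similar, and each side of
  the identity is one of their characteristic polynomials.\<close>

lemma char_poly_invariant_update:
  fixes A :: "'a :: idom mat"
  assumes A: "A \<in> carrier_mat n n" and X: "X \<in> carrier_mat n r"
    and W: "W \<in> carrier_mat r r" and K: "K \<in> carrier_mat r n"
    and AX: "A * X = X * W"
  shows "char_poly (A + X * K) * char_poly W = char_poly A * char_poly (W + K * X)"
proof -
  let ?B = "W + K * X" and ?M = "A + X * K"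
  let ?S = "four_block_mat ?M (0\<^sub>m n r) K W"
  let ?T = "four_block_mat A (0\<^sub>m n r) K ?B"
  let ?P = "four_block_mat (1\<^sub>m n) X (0\<^sub>m r n) (1\<^sub>m r)"
  let ?Q = "four_block_mat (1\<^sub>m n) (- X) (0\<^sub>m r n) (1\<^sub>m r)"
  have B: "?B \<in> carrier_mat r r" and M: "?M \<in> carrier_mat n n"
    using A X W K by auto
  \<comment> \<open>The column space stays invariant after the update, with \<open>?B\<close> in
    place of \<open>W\<close>; this is what will empty the upper right block.\<close>
  have MX: "?M * X = X * ?B"
  proof -
    have "?M * X = X * W + X * K * X"
      using add_mult_distrib_mat[OF A _ X, of "X * K"] X K AX by simp
    also have "\<dots> = X * ?B"
      using mult_add_distrib_mat[OF X W, of "K * X"] assoc_mult_mat[OF X K X] X K by simp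
    finally show ?thesis .
  qed
  \<comment> \<open>These are the upper right block of \<open>?Q * ?P\<close> and the lower right
    block of \<open>?P * ?Q\<close>.\<close>
  have cancel: "X + - X = 0\<^sub>m n r" "- 0\<^sub>m r r + 1\<^sub>m r = (1\<^sub>m r :: 'a mat)"
    using X by (auto intro!: eq_matI)
  have PQ: "?P * ?Q = 1\<^sub>m (n + r)"
    using X cancel by (subst mult_four_block_mat[of _ n n _ r _ r _ _ n _ r])
      (auto simp: uminus_l_inv_mat)
  have QP: "?Q * ?P = 1\<^sub>m (n + r)"
    using X cancel by (subst mult_four_block_mat[of _ n n _ r _ r _ _ n _ r])
      (auto simp: uminus_l_inv_mat)
  \<comment> \<open>\<open>?P\<close> adds \<open>X\<close> times the lower block row to the upper
    one; \<open>?Q\<close> on the right then subtracts the left block column times \<open>X\<close>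
    from the right one.\<close>
  have PT: "?P * ?T = four_block_mat ?M (X * ?B) K ?B"
    using A X K B by (subst mult_four_block_mat[of _ n n _ r _ r _ _ n _ r]) auto
  have KX: "- (K * X) + ?B = W"
    using W K X by (intro eq_matI) auto
  have "?P * ?T * ?Q = four_block_mat ?M (- (?M * X) + X * ?B) K (- (K * X) + ?B)"
    unfolding PT using M X K B
    by (subst mult_four_block_mat[of _ n n _ r _ r _ _ n _ r]) auto
  also have "- (?M * X) + X * ?B = 0\<^sub>m n r"
    unfolding MX using X B by (intro uminus_l_inv_mat) auto
  finally have "?S = ?P * ?T * ?Q" by (simp add: KX)
  then have "similar_mat ?S ?T"
    using A M B X W K PQ QP
    by (intro similar_matI[of _ _ ?P ?Q "n + r"]) auto
  then have "char_poly ?S = char_poly ?T" by (rule char_poly_similar)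
  then show ?thesis
    using A B M W K by (simp add: char_poly_four_block_upper_right_zero)
qed

section \<open>Eigenvector columns and diagonal matrices\<close>

lemma mult_mat_diag_eigenvectors:
  fixes A :: "'a :: field mat"
  assumes A: "A \<in> carrier_mat n n" and X: "X \<in> carrier_mat n r"
    and eig: "\<And>i. i < r \<Longrightarrow> eigenvector A (col X i) (l i)"
  shows "A * X = X * mat_diag r l"
proof (rule eq_matI)
  fix i j assume "i < dim_row (X * mat_diag r l)" "j < dim_col (X * mat_diag r l)"
  then have i: "i < n" and j: "j < r" using X by (auto simp: mat_diag_def)
  have "A *\<^sub>v col X j = l j \<cdot>\<^sub>v col X j"
    using eig[OF j] by (simp add: eigenvector_def)
  then have "(A *\<^sub>v col X j) $ i = l j * X $$ (i, j)"
    using X i j by simp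
  then show "(A * X) $$ (i, j) = (X * mat_diag r l) $$ (i, j)"
    using A X i j by (simp add: mat_diag_mult_right[OF X] mult.commute)
qed (use A X in \<open>auto simp: mat_diag_def\<close>)

lemma char_poly_mat_diag:
  "char_poly (mat_diag r l :: 'a :: comm_ring_1 mat) = (\<Prod>i\<leftarrow>[0..<r]. [:- l i, 1:])"
proof -
  have "char_poly (mat_diag r l) = (\<Prod>a\<leftarrow>diag_mat (mat_diag r l). [:- a, 1:])"
    by (rule char_poly_upper_triangular[of _ r]) (auto simp: mat_diag_def)
  also have "diag_mat (mat_diag r l) = map l [0..<r]"
    by (auto simp: diag_mat_def mat_diag_def)
  finally show ?thesis by (simp add: o_def)
qed

section \<open>The matrix J and the Hamiltonian condition\<close>

lemma J_mat_carrier: "even k \<Longrightarrow> J_mat k \<in> carrier_mat k k"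
  by (auto simp: J_mat_def Let_def elim!: evenE)

lemma transpose_J_mat: "transpose_mat (J_mat k) = - J_mat k"
  unfolding J_mat_def Let_def
  by (subst transpose_four_block_mat) (auto simp: transpose_uminus)

text \<open>Evenness fixes the order: for odd \<open>k\<close> the rounding in
  \<open>k div 2\<close> yields a matrix of order k - 1.\<close>

lemma J_mat_square: "even k \<Longrightarrow> J_mat k * J_mat k = - 1\<^sub>m k"
proof (erule evenE)
  fix h assume k: "k = 2 * h"
  show ?thesis
    unfolding J_mat_def Let_def k
    by (subst mult_four_block_mat[of _ h h _ h _ h _ _ h _ h]) (auto intro!: eq_matI)
qed

lemma ham_transpose_carrier:
  "X \<in> carrier_mat n r \<Longrightarrow> even n \<Longrightarrow> even r \<Longrightarrow> ham_transpose X \<in> carrier_mat r n"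
  by (auto simp: ham_transpose_def intro!: mult_carrier_mat J_mat_carrier)

text \<open>Since J is skew with square -1, multiplying the defining identity by J on both sides
  turns it into symmetry of M J. Symmetry is the convenient form because it survives sums and
  congruences.\<close>

lemma hamiltonian_iff_symmetric:
  fixes M :: "'a :: comm_ring_1 mat"
  assumes M: "M \<in> carrier_mat n n"
  shows "hamiltonian M \<longleftrightarrow> 0 < n \<and> even n \<and> transpose_mat (M * J_mat n) = M * J_mat n"
proof (cases "even n")
  case True
  let ?J = "J_mat n :: 'a mat"
  note J = J_mat_carrier[OF True, where ?'a = 'a] and JJ = J_mat_square[OF True, where ?'a = 'a]
  have Mt: "transpose_mat M \<in> carrier_mat n n" using M by simp
  have T: "transpose_mat (M * ?J) = - (?J * transpose_mat M)"
    using transpose_mult[OF M J] J Mt by (simp add: transpose_J_mat)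
  have zero_iff: "transpose_mat M * ?J + ?J * M = 0\<^sub>m n n \<longleftrightarrow> transpose_mat M * ?J = - (?J * M)"
  proof
    assume "transpose_mat M * ?J + ?J * M = 0\<^sub>m n n"
    moreover have "?J * M + - (?J * M) = 0\<^sub>m n n"
      using J M by (intro eq_matI) auto
    ultimately show "transpose_mat M * ?J = - (?J * M)"
      using J M Mt assoc_add_mat[of "transpose_mat M * ?J" n n "?J * M" "- (?J * M)"]
      by simp
  next
    assume "transpose_mat M * ?J = - (?J * M)"
    then show "transpose_mat M * ?J + ?J * M = 0\<^sub>m n n"
      using J M by (simp add: uminus_l_inv_mat)
  qed
  have JJ_left: "?J * (?J * N) = - N" if "N \<in> carrier_mat n n" for N
    using that J by (simp add: assoc_mult_mat[of _ n n _ n _ n, symmetric] JJ)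
  have JJ_right: "N * ?J * ?J = - N" if "N \<in> carrier_mat n n" for N
    using that J by (simp add: assoc_mult_mat[of _ n n _ n _ n] JJ)
  \<comment> \<open>In each direction a factor J J = -1 is inserted, the assumed identity is applied
    in the middle, and the outer pairs of J collapse again.\<close>
  have "transpose_mat M * ?J = - (?J * M) \<longleftrightarrow> - (?J * transpose_mat M) = M * ?J"
  proof
    assume *: "transpose_mat M * ?J = - (?J * M)"
    have "- (?J * transpose_mat M) = ?J * transpose_mat M * ?J * ?J"
      using J Mt by (intro JJ_right[symmetric]) auto
    also have "\<dots> = ?J * (transpose_mat M * ?J) * ?J"
      using J Mt by (simp add: assoc_mult_mat[of _ n n _ n _ n])
    also have "\<dots> = - (?J * (?J * M)) * ?J"
      unfolding * using J M by simp
    also have "\<dots> = M * ?J" using M by (simp add: JJ_left)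
    finally show "- (?J * transpose_mat M) = M * ?J" .
  next
    assume *: "- (?J * transpose_mat M) = M * ?J"
    have "transpose_mat M * ?J = - (?J * (?J * transpose_mat M)) * ?J"
      using Mt by (simp add: JJ_left)
    also have "\<dots> = ?J * (- (?J * transpose_mat M)) * ?J"
      using J Mt by simp
    also have "\<dots> = ?J * M * ?J * ?J"
      unfolding * using J M by (simp add: assoc_mult_mat[of _ n n _ n _ n])
    also have "\<dots> = - (?J * M)" using J M by (intro JJ_right) auto
    finally show "transpose_mat M * ?J = - (?J * M)" .
  qed
  then show ?thesis
    using True M by (simp add: hamiltonian_def Let_def zero_iff T)
qed (auto simp: hamiltonian_def Let_def M carrier_matD[OF M])

lemma hamiltonian_dims:
  assumes "hamiltonian M" "M \<in> carrier_mat n n"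
  shows "0 < n" "even n"
  using assms by (auto simp: hamiltonian_iff_symmetric)

text \<open>The general coefficient ring lets this serve both the complex update and, for real
  \<open>X\<close>, the real one.\<close>

lemma hamiltonian_update:
  fixes A C X :: "'a :: comm_ring_1 mat"
  assumes A: "A \<in> carrier_mat n n" "hamiltonian A"
    and C: "C \<in> carrier_mat r r" "hamiltonian C"
    and X: "X \<in> carrier_mat n r"
  shows "hamiltonian (A + X * C * ham_transpose X)"
proof -
  let ?J = "J_mat n :: 'a mat"
  define S where "S = C * (J_mat r :: 'a mat)"
  have n: "0 < n" "even n" and r: "even r"
    using hamiltonian_dims[OF A(2,1)] hamiltonian_dims[OF C(2,1)] by auto
  note J = J_mat_carrier[OF n(2), where ?'a = 'a] and Jr = J_mat_carrier[OF r, where ?'a = 'a]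
  have S: "S \<in> carrier_mat r r" "transpose_mat S = S"
    using C Jr by (auto simp: S_def hamiltonian_iff_symmetric)
  have Xt: "transpose_mat X \<in> carrier_mat r n" using X by simp
  \<comment> \<open>The symmetric factor of the perturbation: \<open>S\<close> is symmetric because
    \<open>C\<close> is Hamiltonian, and \<open>K\<close> is congruent to it. Multiplying the
    perturbation \<open>K * ?J\<close> by J once more leaves \<open>- K\<close>.\<close>
  define K where "K = X * S * transpose_mat X"
  have K: "K \<in> carrier_mat n n" using X S unfolding K_def by auto
  have Kt: "transpose_mat K = K"
    using X Xt S unfolding K_def
    by (simp add: transpose_mult[of _ n r _ n] transpose_mult[of _ r r _ n]
        assoc_mult_mat[of _ n r _ r _ n])
  have upd: "X * C * ham_transpose X = K * ?J"
    using X C J Jr Xt unfolding K_def S_def ham_transpose_def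
    by (simp add: assoc_mult_mat[of _ n r _ r _ r] assoc_mult_mat[of _ n r _ r _ n]
      assoc_mult_mat[of _ r r _ r _ r] assoc_mult_mat[of _ r r _ r _ n] assoc_mult_mat[of _ r r _ n _ n]
      assoc_mult_mat[of _ n r _ n _ n])
  have "(A + K * ?J) * ?J = A * ?J + - K"
    using A K J
    by (simp add: add_mult_distrib_mat[of _ n n _ _ n] assoc_mult_mat[of _ n n _ n _ n]
        J_mat_square[OF n(2)])
  moreover have "transpose_mat (A * ?J) = A * ?J"
    using A by (simp add: hamiltonian_iff_symmetric)
  ultimately have "transpose_mat ((A + K * ?J) * ?J) = (A + K * ?J) * ?J"
    using A K J by (simp add: transpose_add[of _ n n] transpose_uminus Kt)
  then show ?thesis
    unfolding upd using A K J n by (subst hamiltonian_iff_symmetric[of _ n]) auto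
qed

section \<open>Passing from real to complex matrices\<close>

lemma map_J_mat: "cmat (J_mat k) = J_mat k"
  unfolding J_mat_def Let_def
  by (subst map_four_block_mat) (auto simp: of_real_hom.mat_hom_one intro!: eq_matI)

lemma cmat_ham_transpose:
  assumes "Y \<in> carrier_mat n r" "even n" "even r"
  shows "cmat (ham_transpose Y) = ham_transpose (cmat Y)"
proof -
  note Jn = J_mat_carrier[OF assms(2), where ?'a = real]
    and Jr = J_mat_carrier[OF assms(3), where ?'a = real]
  have Yt: "transpose_mat Y \<in> carrier_mat r n" using assms(1) by simp
  have "cmat (J_mat r * transpose_mat Y * J_mat n) =
      cmat (J_mat r) * cmat (transpose_mat Y) * cmat (J_mat n)"
    by (simp only: of_real_hom.mat_hom_mult[OF mult_carrier_mat[OF Jr Yt] Jn]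
        of_real_hom.mat_hom_mult[OF Jr Yt])
  then show ?thesis
    using assms(1) by (simp add: ham_transpose_def map_J_mat map_mat_transpose)
qed

lemma cmat_add:
  "A \<in> carrier_mat n m \<Longrightarrow> B \<in> carrier_mat n m \<Longrightarrow> cmat (A + B) = cmat A + cmat B"
  by (intro eq_matI) auto

lemma hamiltonian_cmat:
  assumes "M \<in> carrier_mat n n" "hamiltonian M"
  shows "hamiltonian (cmat M)"
proof -
  have n: "0 < n" "even n" using hamiltonian_dims assms by auto
  have "cmat (M * J_mat n) = cmat M * cmat (J_mat n)"
    by (rule of_real_hom.mat_hom_mult[OF assms(1) J_mat_carrier[OF n(2)]])
  then have "cmat M * J_mat n = cmat (M * J_mat n)" by (simp add: map_J_mat)
  then show ?thesis
    using assms n hamiltonian_iff_symmetric[of "cmat M" n] hamiltonian_iff_symmetric[OF assms(1)]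
    by (simp add: map_mat_transpose)
qed

section \<open>Spectrum of the update\<close>

lemma has_spectrum_update:
  assumes A: "A \<in> carrier_mat n n" and spec: "has_spectrum A lam"
    and r: "r \<le> n" and X: "X \<in> carrier_mat n r" and K: "K \<in> carrier_mat r n"
    and eig: "\<And>i. i < r \<Longrightarrow> eigenvector A (col X i) (lam ! i)"
    and mu: "has_spectrum (mat_diag r (\<lambda>i. lam ! i) + K * X) mu"
  shows "has_spectrum (A + X * K) (mu @ drop r lam)"
proof -
  let ?W = "mat_diag r (\<lambda>i. lam ! i)" and ?f = "\<lambda>e. [:- e, 1:] :: complex poly"
  have len: "length lam = n" "length mu = r"
    using spec mu A X K by (auto simp: has_spectrum_def)
  have W: "char_poly ?W = prod_list (map ?f (take r lam))"
  proof -
    have "map (\<lambda>i. ?f (lam ! i)) [0..<r] = map ?f (take r lam)"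
      using len r by (intro nth_equalityI) auto
    then show ?thesis by (simp add: char_poly_mat_diag)
  qed
  have "A * X = X * ?W" by (rule mult_mat_diag_eigenvectors[OF A X eig])
  then have "char_poly (A + X * K) * char_poly ?W = char_poly A * char_poly (?W + K * X)"
    by (intro char_poly_invariant_update[OF A X _ K]) auto
  \<comment> \<open>Splitting \<open>lam\<close> at position \<open>r\<close> isolates the replaced
    eigenvalues, whose linear factors form \<open>char_poly ?W\<close>.\<close>
  also have "char_poly A = char_poly ?W * prod_list (map ?f (drop r lam))"
    using spec unfolding W has_spectrum_def
    by (metis append_take_drop_id map_append prod_list.append)
  also have "char_poly (?W + K * X) = prod_list (map ?f mu)"
    using mu by (simp add: has_spectrum_def)
  finally have "char_poly ?W * char_poly (A + X * K) =
      char_poly ?W * prod_list (map ?f (mu @ drop r lam))"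
    by (simp add: mult_ac)
  \<comment> \<open>A product of nonzero linear factors, so it cancels even when replaced and
    remaining eigenvalues coincide.\<close>
  moreover have "char_poly ?W \<noteq> 0"
    unfolding W by (auto simp: prod_list_zero_iff)
  ultimately have "char_poly (A + X * K) = prod_list (map ?f (mu @ drop r lam))" by simp
  then show ?thesis
    using A X K len r by (simp add: has_spectrum_def)
qed

text \<open>A real matrix may have non-real eigenvectors, so \<open>X\<close> is complex and the
  update is Hamiltonian for the plain transpose. When \<open>X\<close> is real, the clause about
  \<open>Y\<close> recovers the real notion. Every enumeration \<open>mu\<close> of the spectrum of
  B is covered.\<close>

theorem theorem16:
  fixes n r :: nat
    and A C :: "real mat"
    and X :: "complex mat"
    and lam :: "complex list"
  assumes A: "A \<in> carrier_mat n n" "hamiltonian A"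
    and spec: "has_spectrum (cmat A) lam"
    and r: "r < n"
    and X: "X \<in> carrier_mat n r"
    and eig: "\<And>i. i < r \<Longrightarrow> eigenvector (cmat A) (col X i) (lam ! i)"
    and rank: "vec_space.rank n X = r"
    and C: "C \<in> carrier_mat r r" "hamiltonian C"
  shows "let \<Omega> = mat_diag r (\<lambda>i. lam ! i);
             B = \<Omega> + cmat C * ham_transpose X * X;
             M = cmat A + X * cmat C * ham_transpose X
         in hamiltonian M \<and>
            (\<forall>Y :: real mat. X = cmat Y \<longrightarrow>
               M = cmat (A + Y * C * ham_transpose Y) \<and>
               hamiltonian (A + Y * C * ham_transpose Y)) \<and>
            (\<forall>mu. has_spectrum B mu \<longrightarrow> has_spectrum M (mu @ drop r lam))"
proof -
  let ?K = "cmat C * ham_transpose X"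
  let ?M = "cmat A + X * cmat C * ham_transpose X"
  have even: "even n" "even r"
    using hamiltonian_dims(2)[OF A(2,1)] hamiltonian_dims(2)[OF C(2,1)] by auto
  have H: "ham_transpose X \<in> carrier_mat r n"
    by (rule ham_transpose_carrier[OF X even])
  have K: "?K \<in> carrier_mat r n" using C H by auto
  have "hamiltonian ?M"
    using A C X hamiltonian_cmat by (intro hamiltonian_update) auto
  moreover have "?M = cmat (A + Y * C * ham_transpose Y) \<and>
      hamiltonian (A + Y * C * ham_transpose Y)" if XY: "X = cmat Y" for Y
  proof
    have Y: "Y \<in> carrier_mat n r" using X XY by simp
    have YH: "ham_transpose Y \<in> carrier_mat r n"
      by (rule ham_transpose_carrier[OF Y even])
    have YC: "Y * C \<in> carrier_mat n r" using Y C by auto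
    show "?M = cmat (A + Y * C * ham_transpose Y)"
      using A(1) YC YH
      by (simp add: XY cmat_add[of _ n n] of_real_hom.mat_hom_mult[OF YC YH]
          of_real_hom.mat_hom_mult[OF Y C(1)] cmat_ham_transpose[OF Y even])
    show "hamiltonian (A + Y * C * ham_transpose Y)"
      by (rule hamiltonian_update[OF A C Y])
  qed
  moreover have "has_spectrum ?M (mu @ drop r lam)"
    if "has_spectrum (mat_diag r (\<lambda>i. lam ! i) + ?K * X) mu" for mu
  proof -
    \<comment> \<open>Reassociating exhibits the update as X times a matrix with \<open>r\<close>
      rows, as the spectral result expects.\<close>
    have "?M = cmat A + X * ?K"
      using assoc_mult_mat[OF X _ H, of "cmat C"] C by simp
    then show ?thesis
      using has_spectrum_update[OF _ spec _ X K eig that] A r by simp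
  qed
  ultimately show ?thesis by (simp add: Let_def)
qed

end
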